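(* Let $(X,d)$ be a metric space and let $C(X)$ be the collection of nonempty closed subsets of $X$. Let $\tau_{lf^-}$ and $\tau_{H^-}$ be the lower locally finite topology and the lower Hausdorff metric topology on $C(X)$. If each nonempty closed subset of $X$ has the property $I$, then $\tau_{lf^-}\subset\tau_{H^-}$.
   Context: For a family $\mathcal U$ of nonempty subsets of $X$, $\mathcal U^-=\{C\in C(X):C\cap U\neq\emptyset\ \text{for all } U\in\mathcal U\}$. The lower locally finite topology $\tau_{lf^-}$ on $C(X)$ has as a subbase all sets $\mathcal U^-$ with $\mathcal U$ a locally finite collection of (nonempty) open subsets of $X$. For $C\subset X$ and $\epsilon>0$, $B(C,\epsilon)=\bigcup_{c\in C}B(c,\epsilon)$ is the union of open $\epsilon$-balls. The lower Hausdorff metric topology $\tau_{H^-}$ on $C(X)$ is the topology having, as a local (neighborhood) base at $A\in C(X)$, the sets $B_{H^-}(A,\epsilon)=\{C\in C(X):A\subset B(C,\epsilon)\}$, $\epsilon>0$. A nonempty subset $A$ of $X$ has the property $I$ if for each open $U\subset X$ with $A\subset U$, $\inf\{d(a,U^c):a\in A\}>0$, where $U^c=X\setminus U$ and $d(a,\emptyset)=+\infty$. *)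

theory Defs
  imports "HOL-Analysis.Analysis"
begin

definition closed_hyperspace :: "'a::metric_space set set" where
  "closed_hyperspace = {C. closed C \<and> C \<noteq> {}}"

definition hits_all :: "'a::metric_space set set \<Rightarrow> 'a set set" where
  "hits_all \<U> = {C \<in> closed_hyperspace. \<forall>U\<in>\<U>. C \<inter> U \<noteq> {}}"

text \<open>The generated topology has all of \<^const>\<open>closed_hyperspace\<close> as its space:
  \<open>\<U> = {}\<close> is an admissible family and \<^term>\<open>hits_all {} = closed_hyperspace\<close>.\<close>

definition lower_locally_finite_topology :: "'a::metric_space set topology" where
  "lower_locally_finite_topology = topology_generated_by
     {hits_all \<U> |\<U>. locally_finite_in euclidean \<U> \<and> (\<forall>U\<in>\<U>. open U \<and> U \<noteq> {})}"

definition enlargement :: "'a::metric_space set \<Rightarrow> real \<Rightarrow> 'a set" where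
  "enlargement C \<epsilon> = (\<Union>c\<in>C. ball c \<epsilon>)"

definition lower_hausdorff_nbhd :: "'a::metric_space set \<Rightarrow> real \<Rightarrow> 'a set set" where
  "lower_hausdorff_nbhd A \<epsilon> = {C \<in> closed_hyperspace. A \<subseteq> enlargement C \<epsilon>}"

text \<open>The basic neighborhoods need not be open, so the topology is given by declaring a set open
  iff it contains a basic neighborhood of each of its points. The lemma
  \<open>lower_hausdorff_local_base\<close> below shows that the basic neighborhoods
  are then indeed a local base.\<close>

definition lower_hausdorff_topology :: "'a::metric_space set topology" where
  "lower_hausdorff_topology = topology (\<lambda>W. W \<subseteq> closed_hyperspace \<and>
     (\<forall>A\<in>W. \<exists>\<epsilon>>0. lower_hausdorff_nbhd A \<epsilon> \<subseteq> W))"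

text \<open>Extended-real valued, since \<^const>\<open>infdist\<close> is \<open>0\<close> rather than \<open>\<infinity>\<close> for the empty set.\<close>

definition point_set_dist :: "'a::metric_space \<Rightarrow> 'a set \<Rightarrow> ereal" where
  "point_set_dist a S = (if S = {} then \<infinity> else ereal (infdist a S))"

definition property_I :: "'a::metric_space set \<Rightarrow> bool" where
  "property_I A \<longleftrightarrow> (\<forall>U. open U \<and> A \<subseteq> U \<longrightarrow> (INF a\<in>A. point_set_dist a (- U)) > 0)"

lemma enlargement_mono: "\<delta> \<le> \<epsilon> \<Longrightarrow> enlargement C \<delta> \<subseteq> enlargement C \<epsilon>"
  by (force simp: enlargement_def)

lemma lower_hausdorff_nbhd_mono:
  "\<delta> \<le> \<epsilon> \<Longrightarrow> lower_hausdorff_nbhd A \<delta> \<subseteq> lower_hausdorff_nbhd A \<epsilon>"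
  using enlargement_mono by (fastforce simp: lower_hausdorff_nbhd_def)

lemma lower_hausdorff_nbhd_self:
  "A \<in> closed_hyperspace \<Longrightarrow> \<epsilon> > 0 \<Longrightarrow> A \<in> lower_hausdorff_nbhd A \<epsilon>"
  by (force simp: lower_hausdorff_nbhd_def enlargement_def)

lemma lower_hausdorff_nbhd_trans:
  assumes "B \<in> lower_hausdorff_nbhd A \<delta>" "C \<in> lower_hausdorff_nbhd B \<epsilon>"
  shows "C \<in> lower_hausdorff_nbhd A (\<delta> + \<epsilon>)"
proof -
  have "a \<in> enlargement C (\<delta> + \<epsilon>)" if "a \<in> A" for a
  proof -
    obtain b where b: "b \<in> B" "dist b a < \<delta>"
      using assms(1) \<open>a \<in> A\<close> by (auto simp: lower_hausdorff_nbhd_def enlargement_def)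
    then obtain c where c: "c \<in> C" "dist c b < \<epsilon>"
      using assms(2) by (force simp: lower_hausdorff_nbhd_def enlargement_def)
    have "dist c a < \<delta> + \<epsilon>"
      using b(2) c(2) dist_triangle[of c a b] by linarith
    then show ?thesis
      using c(1) by (auto simp: enlargement_def)
  qed
  then show ?thesis
    using assms(2) by (auto simp: lower_hausdorff_nbhd_def)
qed

lemma istopology_lower_hausdorff:
  "istopology (\<lambda>W. W \<subseteq> closed_hyperspace \<and>
     (\<forall>A\<in>W. \<exists>\<epsilon>>0. lower_hausdorff_nbhd A \<epsilon> \<subseteq> W))"
  unfolding istopology_def
proof (intro conjI allI impI; (elim conjE)?)
  fix S T :: "'a set set"
  assume S: "\<forall>A\<in>S. \<exists>\<epsilon>>0. lower_hausdorff_nbhd A \<epsilon> \<subseteq> S"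
    and T: "\<forall>A\<in>T. \<exists>\<epsilon>>0. lower_hausdorff_nbhd A \<epsilon> \<subseteq> T"
  show "\<forall>A\<in>S \<inter> T. \<exists>\<epsilon>>0. lower_hausdorff_nbhd A \<epsilon> \<subseteq> S \<inter> T"
  proof
    fix A assume "A \<in> S \<inter> T"
    then obtain d e where "d > 0" "e > 0"
      "lower_hausdorff_nbhd A d \<subseteq> S" "lower_hausdorff_nbhd A e \<subseteq> T"
      using S T by blast
    then show "\<exists>\<epsilon>>0. lower_hausdorff_nbhd A \<epsilon> \<subseteq> S \<inter> T"
      using lower_hausdorff_nbhd_mono[of "min d e" d A] lower_hausdorff_nbhd_mono[of "min d e" e A]
      by (intro exI[of _ "min d e"]) auto
  qed
next
  fix \<K> :: "'a set set set"
  assume *: "\<forall>K\<in>\<K>. K \<subseteq> closed_hyperspace \<and>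
     (\<forall>A\<in>K. \<exists>\<epsilon>>0. lower_hausdorff_nbhd A \<epsilon> \<subseteq> K)"
  then show "\<Union>\<K> \<subseteq> closed_hyperspace"
    by blast
  show "\<forall>A\<in>\<Union>\<K>. \<exists>\<epsilon>>0. lower_hausdorff_nbhd A \<epsilon> \<subseteq> \<Union>\<K>"
    using * by (meson Sup_upper UnionE order_trans)
qed blast

lemma openin_lower_hausdorff:
  "openin lower_hausdorff_topology W \<longleftrightarrow>
     W \<subseteq> closed_hyperspace \<and> (\<forall>A\<in>W. \<exists>\<epsilon>>0. lower_hausdorff_nbhd A \<epsilon> \<subseteq> W)"
  unfolding lower_hausdorff_topology_def
  by (simp add: topology_inverse' istopology_lower_hausdorff)

lemma lower_hausdorff_local_base:
  fixes A :: "'a::metric_space set"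
  assumes A: "A \<in> closed_hyperspace"
  shows "(\<exists>W. openin lower_hausdorff_topology W \<and> A \<in> W \<and> W \<subseteq> N) \<longleftrightarrow>
         (\<exists>\<epsilon>>0. lower_hausdorff_nbhd A \<epsilon> \<subseteq> N)"
proof
  assume "\<exists>W. openin lower_hausdorff_topology W \<and> A \<in> W \<and> W \<subseteq> N"
  then show "\<exists>\<epsilon>>0. lower_hausdorff_nbhd A \<epsilon> \<subseteq> N"
    by (meson openin_lower_hausdorff order_trans)
next
  assume "\<exists>\<epsilon>>0. lower_hausdorff_nbhd A \<epsilon> \<subseteq> N"
  then obtain e where e: "e > 0" "lower_hausdorff_nbhd A e \<subseteq> N"
    by blast
  define W where "W = {B \<in> closed_hyperspace. \<exists>\<delta>>0. lower_hausdorff_nbhd B \<delta> \<subseteq> N}"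
  have "\<exists>\<delta>>0. lower_hausdorff_nbhd B \<delta> \<subseteq> W" if B: "B \<in> W" for B
  proof -
    obtain d where d: "d > 0" "lower_hausdorff_nbhd B d \<subseteq> N"
      using B by (auto simp: W_def)
    have "C \<in> W" if C: "C \<in> lower_hausdorff_nbhd B (d/2)" for C
    proof -
      have "lower_hausdorff_nbhd C (d/2) \<subseteq> lower_hausdorff_nbhd B d"
        using lower_hausdorff_nbhd_trans[OF C, of _ "d/2"] by auto
      moreover have "C \<in> closed_hyperspace"
        using C by (simp add: lower_hausdorff_nbhd_def)
      ultimately show ?thesis
        using d by (auto simp: W_def intro!: exI[of _ "d/2"])
    qed
    then show ?thesis
      using d(1) by (intro exI[of _ "d/2"]) auto
  qed
  then have "openin lower_hausdorff_topology W"
    by (auto simp: openin_lower_hausdorff W_def)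
  moreover have "A \<in> W"
    using A e by (auto simp: W_def)
  moreover have "W \<subseteq> N"
    using lower_hausdorff_nbhd_self by (fastforce simp: W_def)
  ultimately show "\<exists>W. openin lower_hausdorff_topology W \<and> A \<in> W \<and> W \<subseteq> N"
    by blast
qed

end

theory Submission
  imports Defs
begin

text \<open>Suppose that a closed set \<open>A\<close> hits all members of a locally finite open family \<open>\<U>\<close>, but
  no \<open>\<epsilon>\<close> is such that every \<open>U \<in> \<U>\<close> contains the \<open>\<epsilon>\<close>-ball about some point of
  \<open>A \<inter> U\<close>. This yields \<open>U\<^sub>n \<in> \<U>\<close>, \<open>p\<^sub>n \<in> A \<inter> U\<^sub>n\<close> and
  \<open>q\<^sub>n \<notin> U\<^sub>n\<close> with \<open>d(p\<^sub>n, q\<^sub>n) \<rightarrow> 0\<close>. Each member of \<open>\<U>\<close> occurs only finitely often, so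
  by local finiteness neither sequence has a cluster point. Hence, along a common subsequence,
  the two ranges are disjoint closed sets at distance \<open>0\<close>, contradicting property \<open>I\<close>.\<close>

text \<open>Indices are counted, not values: this says that \<open>p\<close> has no cluster point,
  so it also takes each value only finitely often.\<close>

definition discrete_seq :: "(nat \<Rightarrow> 'a::metric_space) \<Rightarrow> bool" where
  "discrete_seq p \<longleftrightarrow> (\<forall>x. \<exists>e>0. finite {n. p n \<in> ball x e})"

text \<open>Some ball about each point meets the image in a finite set, so there are no limit
  points. The arbitrary index set \<open>S\<close> allows for subsequences.\<close>

lemma discrete_seq_closed_image:
  assumes "discrete_seq p"
  shows "closed (p ` S)"
proof -
  have "\<not> x islimpt p ` S" for x
  proof -
    obtain e where e: "e > 0" "finite {n. p n \<in> ball x e}"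
      using assms by (auto simp: discrete_seq_def)
    have "p ` S \<inter> ball x e \<subseteq> p ` {n. p n \<in> ball x e}"
      by auto
    then have "finite (p ` S \<inter> ball x e)"
      using e(2) finite_surj by blast
    then show ?thesis
      using e(1) islimpt_eq_infinite_ball by blast
  qed
  then show ?thesis
    by (simp add: closed_limpt)
qed

lemma discrete_seq_eventually_neq:
  assumes "discrete_seq p"
  shows "\<forall>\<^sub>F n in sequentially. p n \<noteq> x"
proof -
  obtain e where "e > 0" "finite {n. p n \<in> ball x e}"
    using assms by (auto simp: discrete_seq_def)
  then have "finite {n. p n = x}"
    by (rule_tac finite_subset[of _ "{n. p n \<in> ball x e}"]) auto
  then show ?thesis
    by (simp add: eventually_cofinite flip: cofinite_eq_sequentially)
qed

lemma discrete_seq_close: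
  assumes p: "discrete_seq p" and lim: "(\<lambda>n. dist (p n) (q n)) \<longlonglongrightarrow> 0"
  shows "discrete_seq q"
  unfolding discrete_seq_def
proof
  fix x
  obtain e where e: "e > 0" "finite {n. p n \<in> ball x e}"
    using p by (auto simp: discrete_seq_def)
  have "\<forall>\<^sub>F n in sequentially. dist (p n) (q n) < e/2"
    using e(1) by (intro order_tendstoD(2)[OF lim]) simp
  then have fin: "finite {n. \<not> dist (p n) (q n) < e/2}"
    by (simp add: eventually_cofinite flip: cofinite_eq_sequentially)
  \<comment> \<open>Halving the radius leaves room for the distance from \<open>q n\<close> to
    \<open>p n\<close>, outside finitely many indices.\<close>
  have "{n. q n \<in> ball x (e/2)} \<subseteq> {n. p n \<in> ball x e} \<union> {n. \<not> dist (p n) (q n) < e/2}"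
    using dist_triangle_half_l by (fastforce simp: dist_commute)
  then show "\<exists>e>0. finite {n. q n \<in> ball x e}"
    using e fin by (intro exI[of _ "e/2"]) (auto intro: finite_subset)
qed

text \<open>Both sequences eventually avoid any finite set, so indices can be chosen recursively,
  each avoiding the earlier values of the other sequence; \<open>neq\<close> settles equal
  indices.\<close>

lemma subsequence_disjoint_images:
  fixes p q :: "nat \<Rightarrow> 'a::metric_space"
  assumes p: "discrete_seq p" and q: "discrete_seq q" and neq: "\<And>n. p n \<noteq> q n"
  obtains r :: "nat \<Rightarrow> nat" where "strict_mono r" "p ` range r \<inter> q ` range r = {}"
proof -
  have "\<forall>\<^sub>F n in sequentially. n > k \<and> (\<forall>m\<in>{..k}. p n \<noteq> q m \<and> q n \<noteq> p m)" for k
    by (intro eventually_conj eventually_gt_at_top eventually_ball_finite ballI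
        discrete_seq_eventually_neq p q finite_atMost)
  then have "\<exists>n. n > k \<and> (\<forall>m\<le>k. p n \<noteq> q m \<and> q n \<noteq> p m)" for k
    by (force simp: eventually_sequentially)
  then obtain r :: "nat \<Rightarrow> nat" where r: "\<And>k. r (Suc k) > r k"
    "\<And>k m. m \<le> r k \<Longrightarrow> p (r (Suc k)) \<noteq> q m \<and> q (r (Suc k)) \<noteq> p m"
    using dependent_nat_choice[of "\<lambda>_ _. True"
        "\<lambda>_ k n. n > k \<and> (\<forall>m\<le>k. p n \<noteq> q m \<and> q n \<noteq> p m)"] by blast
  have mono: "strict_mono r"
    using r(1) by (simp add: strict_mono_Suc_iff)
  \<comment> \<open>The choice of \<open>r (Suc k)\<close> took care of every index up to
    \<open>r k\<close>, hence of all earlier terms of the subsequence at once.\<close>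
  have less: "p (r j) \<noteq> q (r i) \<and> q (r j) \<noteq> p (r i)" if "i < j" for i j
  proof -
    obtain k where k: "j = Suc k"
      using \<open>i < j\<close> by (cases j) auto
    then have "r i \<le> r k"
      using that mono by (simp add: strict_mono_less_eq)
    then show ?thesis
      using r(2) k by blast
  qed
  have "p (r i) \<noteq> q (r j)" for i j
    using less[of i j] less[of j i] neq by (cases i j rule: linorder_cases) auto
  then show thesis
    using mono that by blast
qed

text \<open>Otherwise property I of the closed set \<open>P\<close>, applied to the open set
  \<open>- Q\<close>, keeps \<open>P\<close> at a positive distance from \<open>Q\<close>, while the
  paired points come arbitrarily close.\<close>

lemma property_I_discrete_seq_eq:
  fixes p q :: "nat \<Rightarrow> 'a::metric_space"
  assumes I: "\<forall>A \<in> (closed_hyperspace :: 'a set set). property_I A"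
    and p: "discrete_seq p" and lim: "(\<lambda>n. dist (p n) (q n)) \<longlonglongrightarrow> 0"
  shows "\<exists>n. p n = q n"
proof (rule ccontr)
  assume "\<nexists>n. p n = q n"
  moreover have q: "discrete_seq q"
    using p lim by (rule discrete_seq_close)
  ultimately obtain r :: "nat \<Rightarrow> nat"
    where r: "strict_mono r" "p ` range r \<inter> q ` range r = {}"
    using subsequence_disjoint_images[OF p] by metis
  define P Q where "P = p ` range r" and "Q = q ` range r"
  have "P \<subseteq> - Q"
    using r(2) unfolding P_def Q_def by blast
  moreover have "P \<in> closed_hyperspace" "open (- Q)"
    using discrete_seq_closed_image[OF p] discrete_seq_closed_image[OF q]
    by (auto simp: closed_hyperspace_def P_def Q_def)
  ultimately have pos: "(INF a\<in>P. point_set_dist a Q) > 0"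
    using I unfolding property_I_def by fastforce
  have le: "(INF a\<in>P. point_set_dist a Q) \<le> ereal (dist (p (r n)) (q (r n)))" for n
  proof -
    have "(INF a\<in>P. point_set_dist a Q) \<le> point_set_dist (p (r n)) Q"
      by (intro INF_lower) (simp add: P_def)
    also have "\<dots> \<le> ereal (dist (p (r n)) (q (r n)))"
      by (auto simp: point_set_dist_def Q_def intro!: infdist_le)
    finally show ?thesis .
  qed
  have "(\<lambda>n. ereal (dist (p (r n)) (q (r n)))) \<longlonglongrightarrow> ereal 0"
    using LIMSEQ_subseq_LIMSEQ[OF lim r(1)] by (simp add: o_def)
  then have "(INF a\<in>P. point_set_dist a Q) \<le> ereal 0"
    by (rule LIMSEQ_le_const) (use le in blast)
  with pos show False
    by (simp add: zero_ereal_def)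
qed

text \<open>A single \<epsilon> serving all members of the family is what turns a Hausdorff
  neighborhood into a subset of \<open>hits_all \<U>\<close>.\<close>

lemma uniform_ball_in_locally_finite:
  fixes A :: "'a::metric_space set"
  assumes I: "\<forall>A \<in> (closed_hyperspace :: 'a set set). property_I A"
    and lf: "locally_finite_in euclidean \<U>" and op: "\<And>U. U \<in> \<U> \<Longrightarrow> open U"
    and hit: "\<And>U. U \<in> \<U> \<Longrightarrow> A \<inter> U \<noteq> {}"
  shows "\<exists>\<epsilon>>0. \<forall>U\<in>\<U>. \<exists>a\<in>A \<inter> U. ball a \<epsilon> \<subseteq> U"
proof (rule ccontr)
  assume "\<not> ?thesis"
  then have "\<exists>U. U \<in> \<U> \<and> (\<forall>a\<in>A \<inter> U. \<not> ball a (1 / real (Suc n)) \<subseteq> U)" for n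
    by (metis of_nat_0_less_iff zero_less_Suc zero_less_divide_1_iff)
  then obtain V where V: "\<And>n. V n \<in> \<U>"
    "\<And>n a. a \<in> A \<inter> V n \<Longrightarrow> \<not> ball a (1 / real (Suc n)) \<subseteq> V n"
    by metis
  have "\<exists>a. a \<in> A \<inter> V n" for n
    using hit V(1) by blast
  then obtain p where p: "\<And>n. p n \<in> A \<inter> V n"
    by metis
  have "\<exists>x. x \<in> ball (p n) (1 / real (Suc n)) \<and> x \<notin> V n" for n
    using V(2)[OF p] by blast
  then obtain q where q: "\<And>n. q n \<in> ball (p n) (1 / real (Suc n))" "\<And>n. q n \<notin> V n"
    by metis
  \<comment> \<open>One ball inside \<open>U\<close> about a point of \<open>A\<close> suffices:
    once \<open>1 / real (Suc n)\<close> drops below its radius, \<open>V n = U\<close> would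
    contradict the choice of \<open>V n\<close>.\<close>
  have fin: "finite {n. V n = U}" if U: "U \<in> \<U>" for U
  proof -
    obtain a e where a: "a \<in> A \<inter> U" "e > 0" "ball a e \<subseteq> U"
      using hit[OF U] op[OF U] by (meson IntD2 equals0I openE)
    obtain N where N: "inverse (real (Suc N)) < e"
      using reals_Archimedean a(2) by blast
    have "n \<le> N" if "V n = U" for n
    proof (rule ccontr)
      assume "\<not> n \<le> N"
      then have "1 / real (Suc n) \<le> inverse (real (Suc N))"
        by (simp add: field_simps)
      with N have "ball a (1 / real (Suc n)) \<subseteq> ball a e"
        by (intro subset_ball) simp
      with a V(2)[of a n] that show False
        by auto
    qed
    then show ?thesis
      by (auto intro: finite_subset[of _ "{..N}"])
  qed
  have "discrete_seq p"
    unfolding discrete_seq_def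
  proof
    fix x
    obtain W where W: "open W" "x \<in> W" "finite {U \<in> \<U>. U \<inter> W \<noteq> {}}"
      using lf by (auto simp: locally_finite_in_def)
    then obtain e where e: "e > 0" "ball x e \<subseteq> W"
      by (meson openE)
    \<comment> \<open>Since \<open>p n\<close> lies in \<open>V n\<close>, it can be in
      \<open>W\<close> only if \<open>V n\<close> is one of the finitely many members meeting
      \<open>W\<close>.\<close>
    have "{n. p n \<in> ball x e} \<subseteq> (\<Union>U\<in>{U \<in> \<U>. U \<inter> W \<noteq> {}}. {n. V n = U})"
      using e(2) p V(1) by blast
    moreover have "finite (\<Union>U\<in>{U \<in> \<U>. U \<inter> W \<noteq> {}}. {n. V n = U})"
      using W(3) fin by blast
    ultimately show "\<exists>e>0. finite {n. p n \<in> ball x e}"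
      using e(1) finite_subset by blast
  qed
  moreover have "(\<lambda>n. dist (p n) (q n)) \<longlonglongrightarrow> 0"
  proof (rule tendsto_sandwich[OF _ _ tendsto_const])
    show "(\<lambda>n. 1 / real (Suc n)) \<longlonglongrightarrow> 0"
      using LIMSEQ_inverse_real_of_nat by (simp add: inverse_eq_divide)
    show "\<forall>\<^sub>F n in sequentially. dist (p n) (q n) \<le> 1 / real (Suc n)"
      using q(1) by (intro always_eventually allI) (simp add: less_imp_le)
  qed simp
  ultimately obtain n where "p n = q n"
    using property_I_discrete_seq_eq[OF I] by blast
  then show False
    using p[of n] q(2)[of n] by auto
qed

lemma openin_lower_hausdorff_hits_all:
  fixes \<U> :: "'a::metric_space set set"
  assumes I: "\<forall>A \<in> (closed_hyperspace :: 'a set set). property_I A"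
    and lf: "locally_finite_in euclidean \<U>" and op: "\<And>U. U \<in> \<U> \<Longrightarrow> open U"
  shows "openin lower_hausdorff_topology (hits_all \<U>)"
  unfolding openin_lower_hausdorff
proof (intro conjI ballI)
  show "hits_all \<U> \<subseteq> closed_hyperspace"
    by (auto simp: hits_all_def)
next
  fix A assume "A \<in> hits_all \<U>"
  then obtain \<epsilon> where \<epsilon>: "\<epsilon> > 0" "\<And>U. U \<in> \<U> \<Longrightarrow> \<exists>a\<in>A \<inter> U. ball a \<epsilon> \<subseteq> U"
    using uniform_ball_in_locally_finite[OF I lf op, of A] by (auto simp: hits_all_def)
  \<comment> \<open>Some point of \<open>C\<close> is within \<epsilon> of the centre
    \<open>a\<close>, hence lies in the ball inside \<open>U\<close>.\<close>
  have "C \<inter> U \<noteq> {}" if C: "C \<in> lower_hausdorff_nbhd A \<epsilon>" and U: "U \<in> \<U>" for C U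
  proof -
    obtain a where a: "a \<in> A" "ball a \<epsilon> \<subseteq> U"
      using \<epsilon>(2)[OF U] by blast
    then obtain c where "c \<in> C" "a \<in> ball c \<epsilon>"
      using C by (auto simp: lower_hausdorff_nbhd_def enlargement_def)
    with a(2) show ?thesis
      by (auto simp: dist_commute)
  qed
  then show "\<exists>\<epsilon>>0. lower_hausdorff_nbhd A \<epsilon> \<subseteq> hits_all \<U>"
    using \<epsilon>(1) by (auto simp: hits_all_def lower_hausdorff_nbhd_def intro!: exI[of _ \<epsilon>])
qed

theorem theorem5p1:
  assumes "\<forall>A \<in> (closed_hyperspace :: 'a::metric_space set set). property_I A"
  shows "{W. openin (lower_locally_finite_topology :: 'a set topology) W}
       \<subseteq> {W. openin (lower_hausdorff_topology :: 'a set topology) W}"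
proof clarify
  fix W :: "'a set set"
  assume "openin lower_locally_finite_topology W"
  then have "generate_topology_on
      {hits_all \<U> |\<U>. locally_finite_in euclidean \<U> \<and> (\<forall>U\<in>\<U>. open U \<and> U \<noteq> {})} W"
    unfolding lower_locally_finite_topology_def by (rule openin_topology_generated_by)
  then show "openin lower_hausdorff_topology W"
    \<comment> \<open>The generated topology is the coarsest one containing the subbase, so only the
      sets \<open>hits_all \<U>\<close> need checking.\<close>
    by (rule generate_topology_on_coarsest[OF istopology_openin, rotated])
      (use openin_lower_hausdorff_hits_all[OF assms] in blast)
qed

end
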